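(* For all integers $m,n,m',n'\ge 0$, the polynomial $H_{m,n,m',n'}$ is an eigenfunction of each of the second order differential operators $$L_{\xi}=\xi A_{\xi}-A_{\xi}A_{\overline{\xi}},\quad L_{\overline{\xi}}=\overline{\xi}A_{\overline{\xi}}-A_{\xi}A_{\overline{\xi}},\quad L_{\xi^*}=\xi^*A_{\xi^*}-A_{\xi^*}A_{\widetilde{\xi}},\quad L_{\widetilde{\xi}}=\widetilde{\xi}A_{\widetilde{\xi}}-A_{\xi^*}A_{\widetilde{\xi}},$$ with corresponding eigenvalues $m$, $n$, $m'$ and $n'$ respectively; that is, $L_{\xi}H_{m,n,m',n'}=m\,H_{m,n,m',n'}$, $L_{\overline{\xi}}H_{m,n,m',n'}=n\,H_{m,n,m',n'}$, $L_{\xi^*}H_{m,n,m',n'}=m'\,H_{m,n,m',n'}$ and $L_{\widetilde{\xi}}H_{m,n,m',n'}=n'\,H_{m,n,m',n'}$.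
   Context: For integers $m,n\ge 0$ and $\zeta\in\mathbb{C}$, $H_{m,n}(\zeta,\overline{\zeta})=(-1)^{m+n}e^{|\zeta|^2}\frac{\partial^{m+n}}{\partial\overline{\zeta}^{m}\partial\zeta^{n}}\left(e^{-|\zeta|^2}\right)$ (Wirtinger derivatives). For $(z,w)\in\mathbb{C}^2$ set $\xi=z+iw$, $\overline{\xi}=\overline{z}-i\overline{w}$, $\xi^*=\overline{z}+i\overline{w}$, $\widetilde{\xi}=z-iw$ (also used for the corresponding multiplication operators), and define $H_{m,n,m',n'}(z,w)=H_{m,n}(\xi,\overline{\xi})\,H_{m',n'}(\xi^*,\widetilde{\xi})$. The first order differential operators are $A_{\xi}=\frac12\left(\frac{\partial}{\partial z}-i\frac{\partial}{\partial w}\right)$, $A_{\xi^*}=\frac12\left(\frac{\partial}{\partial\overline{z}}-i\frac{\partial}{\partial\overline{w}}\right)$, $A_{\overline{\xi}}=\frac12\left(\frac{\partial}{\partial\overline{z}}+i\frac{\partial}{\partial\overline{w}}\right)$, $A_{\widetilde{\xi}}=\frac12\left(\frac{\partial}{\partial z}+i\frac{\partial}{\partial w}\right)$. *)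

theory Defs
  imports "HOL-Analysis.Analysis"
begin

text \<open>
  For $\zeta = x + iy$: $\partial/\partial\zeta = \frac12(\partial_x - i\,\partial_y)$ and
  $\partial/\partial\overline{\zeta} = \frac12(\partial_x + i\,\partial_y)$, with \<open>x\<close> and \<open>y\<close> real;
  the function need not be holomorphic.
\<close>

definition partial_re :: "(complex \<Rightarrow> complex) \<Rightarrow> complex \<Rightarrow> complex" where
  "partial_re f \<zeta> = vector_derivative (\<lambda>t::real. f (\<zeta> + of_real t)) (at 0)"

definition partial_im :: "(complex \<Rightarrow> complex) \<Rightarrow> complex \<Rightarrow> complex" where
  "partial_im f \<zeta> = vector_derivative (\<lambda>t::real. f (\<zeta> + \<i> * of_real t)) (at 0)"

definition wirtinger :: "(complex \<Rightarrow> complex) \<Rightarrow> complex \<Rightarrow> complex" where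
  "wirtinger f \<zeta> = (partial_re f \<zeta> - \<i> * partial_im f \<zeta>) / 2"

definition wirtinger_cnj :: "(complex \<Rightarrow> complex) \<Rightarrow> complex \<Rightarrow> complex" where
  "wirtinger_cnj f \<zeta> = (partial_re f \<zeta> + \<i> * partial_im f \<zeta>) / 2"

text \<open>
  \<open>hermite_H m n \<zeta>\<close> is $H_{m,n}(\zeta,\overline{\zeta})$; the second argument is always the conjugate
  of the first and is therefore dropped.
\<close>

definition hermite_H :: "nat \<Rightarrow> nat \<Rightarrow> complex \<Rightarrow> complex" where
  "hermite_H m n \<zeta> =
     (-1) ^ (m + n) * of_real (exp ((cmod \<zeta>)\<^sup>2)) *
     (wirtinger_cnj ^^ m) ((wirtinger ^^ n) (\<lambda>u. of_real (exp (- (cmod u)\<^sup>2)))) \<zeta>"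

type_synonym fun2 = "complex \<times> complex \<Rightarrow> complex"

definition D_z :: "fun2 \<Rightarrow> fun2" where
  "D_z f = (\<lambda>(z, w). wirtinger (\<lambda>u. f (u, w)) z)"

definition D_zbar :: "fun2 \<Rightarrow> fun2" where
  "D_zbar f = (\<lambda>(z, w). wirtinger_cnj (\<lambda>u. f (u, w)) z)"

definition D_w :: "fun2 \<Rightarrow> fun2" where
  "D_w f = (\<lambda>(z, w). wirtinger (\<lambda>u. f (z, u)) w)"

definition D_wbar :: "fun2 \<Rightarrow> fun2" where
  "D_wbar f = (\<lambda>(z, w). wirtinger_cnj (\<lambda>u. f (z, u)) w)"

definition xi :: fun2 where "xi = (\<lambda>(z, w). z + \<i> * w)"
definition xi_bar :: fun2 where "xi_bar = (\<lambda>(z, w). cnj z - \<i> * cnj w)"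
definition xi_star :: fun2 where "xi_star = (\<lambda>(z, w). cnj z + \<i> * cnj w)"
definition xi_tilde :: fun2 where "xi_tilde = (\<lambda>(z, w). z - \<i> * w)"

text \<open>
  These two identities justify evaluating $H_{m,n}(\xi,\overline{\xi})$ and
  $H_{m',n'}(\xi^*,\widetilde{\xi})$ by the one-argument function \<open>hermite_H\<close>.
\<close>

lemma xi_bar_eq_cnj_xi: "xi_bar p = cnj (xi p)"
  by (simp add: xi_bar_def xi_def split: prod.split)

lemma xi_tilde_eq_cnj_xi_star: "xi_tilde p = cnj (xi_star p)"
  by (simp add: xi_tilde_def xi_star_def split: prod.split)

definition hermite_H4 :: "nat \<Rightarrow> nat \<Rightarrow> nat \<Rightarrow> nat \<Rightarrow> fun2" where
  "hermite_H4 m n m' n' = (\<lambda>p. hermite_H m n (xi p) * hermite_H m' n' (xi_star p))"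

definition A_xi :: "fun2 \<Rightarrow> fun2" where
  "A_xi f = (\<lambda>p. (1/2) * (D_z f p - \<i> * D_w f p))"

definition A_xi_star :: "fun2 \<Rightarrow> fun2" where
  "A_xi_star f = (\<lambda>p. (1/2) * (D_zbar f p - \<i> * D_wbar f p))"

definition A_xi_bar :: "fun2 \<Rightarrow> fun2" where
  "A_xi_bar f = (\<lambda>p. (1/2) * (D_zbar f p + \<i> * D_wbar f p))"

definition A_xi_tilde :: "fun2 \<Rightarrow> fun2" where
  "A_xi_tilde f = (\<lambda>p. (1/2) * (D_z f p + \<i> * D_w f p))"

definition L_xi :: "fun2 \<Rightarrow> fun2" where
  "L_xi f = (\<lambda>p. xi p * A_xi f p - A_xi (A_xi_bar f) p)"

definition L_xi_bar :: "fun2 \<Rightarrow> fun2" where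
  "L_xi_bar f = (\<lambda>p. xi_bar p * A_xi_bar f p - A_xi (A_xi_bar f) p)"

definition L_xi_star :: "fun2 \<Rightarrow> fun2" where
  "L_xi_star f = (\<lambda>p. xi_star p * A_xi_star f p - A_xi_star (A_xi_tilde f) p)"

definition L_xi_tilde :: "fun2 \<Rightarrow> fun2" where
  "L_xi_tilde f = (\<lambda>p. xi_tilde p * A_xi_tilde f p - A_xi_star (A_xi_tilde f) p)"

definition eigenfunction :: "(fun2 \<Rightarrow> fun2) \<Rightarrow> complex \<Rightarrow> fun2 \<Rightarrow> bool" where
  "eigenfunction L c f \<longleftrightarrow> f \<noteq> (\<lambda>_. 0) \<and> L f = (\<lambda>p. c * f p)"

end

theory Submission imports Defs begin

text \<open>
  Writing $\partial^m_{\overline\zeta}\partial^n_\zeta e^{-|\zeta|^2}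
  = (-1)^{m+n} H_{m,n} e^{-|\zeta|^2}$ and differentiating gives
  $\partial_\zeta H_{m,n} = m H_{m-1,n}$, $\partial_{\overline\zeta} H_{m,n} = n H_{m,n-1}$ and the
  two recurrences $H_{m+1,n} = \zeta H_{m,n} - n H_{m,n-1}$,
  $H_{m,n+1} = \overline\zeta H_{m,n} - m H_{m-1,n}$. In the coordinates $\xi, \xi^*$ the four operators
  $A$ are the Wirtinger derivatives in the separate variables $\xi$ and $\xi^*$, so the eigenvalue
  equations are these recurrences.
\<close>

text \<open>A real-linear map of the plane splits uniquely into a complex-linear and a
  conjugate-linear part; their coefficients are the two Wirtinger derivatives. Unlike the values of
  \<open>vector_derivative\<close>, this relation carries differentiability through sums, products
  and compositions.\<close>

definition has_wirtinger ::
    "(complex \<Rightarrow> complex) \<Rightarrow> complex \<Rightarrow> complex \<Rightarrow> complex \<Rightarrow> bool" where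
  "has_wirtinger f a b \<zeta> \<longleftrightarrow> (f has_derivative (\<lambda>h. a * h + b * cnj h)) (at \<zeta>)"

text \<open>The directions \<open>v = 1\<close> and \<open>v = \<i>\<close> give the two partial
  derivatives.\<close>

lemma has_wirtinger_along:
  assumes "has_wirtinger f a b \<zeta>"
  shows "vector_derivative (\<lambda>t::real. f (\<zeta> + v * of_real t)) (at 0) = a * v + b * cnj v"
proof -
  have "((\<lambda>t::real. f (\<zeta> + v * of_real t)) has_derivative
      (\<lambda>t. a * (v * of_real t) + b * cnj (v * of_real t))) (at 0)"
    by (rule has_derivative_compose[where g = f and f = "\<lambda>t::real. \<zeta> + v * of_real t"])
      (use assms in \<open>auto intro!: derivative_eq_intros simp: has_wirtinger_def\<close>)
  then show ?thesis
    by (intro vector_derivative_at)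
      (simp add: has_vector_derivative_def scaleR_conv_of_real algebra_simps)
qed

lemma has_wirtinger_imp_wirtinger:
  assumes "has_wirtinger f a b \<zeta>"
  shows "wirtinger f \<zeta> = a" "wirtinger_cnj f \<zeta> = b"
proof -
  have "partial_re f \<zeta> = a + b" "partial_im f \<zeta> = \<i> * (a - b)"
    using has_wirtinger_along[OF assms, of 1] has_wirtinger_along[OF assms, of \<i>]
    by (simp_all add: partial_re_def partial_im_def right_diff_distrib mult.commute)
  then show "wirtinger f \<zeta> = a" "wirtinger_cnj f \<zeta> = b"
    by (simp_all add: wirtinger_def wirtinger_cnj_def flip: mult.assoc)
qed

lemma has_wirtinger_ident: "has_wirtinger (\<lambda>u. u) 1 0 \<zeta>"
  by (auto simp: has_wirtinger_def)

lemma has_wirtinger_cnj: "has_wirtinger cnj 0 1 \<zeta>"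
  by (auto simp: has_wirtinger_def intro!: derivative_eq_intros)

lemma has_wirtinger_const: "has_wirtinger (\<lambda>u. c) 0 0 \<zeta>"
  by (auto simp: has_wirtinger_def)

lemma has_wirtinger_add:
  "has_wirtinger f a b \<zeta> \<Longrightarrow> has_wirtinger g c d \<zeta> \<Longrightarrow>
    has_wirtinger (\<lambda>u. f u + g u) (a + c) (b + d) \<zeta>"
  unfolding has_wirtinger_def
  by (auto intro!: derivative_eq_intros simp: algebra_simps)

lemma has_wirtinger_diff:
  "has_wirtinger f a b \<zeta> \<Longrightarrow> has_wirtinger g c d \<zeta> \<Longrightarrow>
    has_wirtinger (\<lambda>u. f u - g u) (a - c) (b - d) \<zeta>"
  unfolding has_wirtinger_def
  by (auto intro!: derivative_eq_intros simp: algebra_simps)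

lemma has_wirtinger_mult:
  "has_wirtinger f a b \<zeta> \<Longrightarrow> has_wirtinger g c d \<zeta> \<Longrightarrow>
    has_wirtinger (\<lambda>u. f u * g u) (a * g \<zeta> + f \<zeta> * c) (b * g \<zeta> + f \<zeta> * d) \<zeta>"
  unfolding has_wirtinger_def
  by (auto intro!: derivative_eq_intros simp: algebra_simps)

lemma has_wirtinger_cmult:
  "has_wirtinger f a b \<zeta> \<Longrightarrow> has_wirtinger (\<lambda>u. c * f u) (c * a) (c * b) \<zeta>"
  using has_wirtinger_mult[OF has_wirtinger_const, of f a b \<zeta> c] by simp

text \<open>Conjugating the inner derivative swaps its two parts, so \<open>d\<close> meets
  \<open>cnj b\<close> and \<open>cnj a\<close>.\<close>

lemma has_wirtinger_compose:
  assumes "has_wirtinger g a b \<zeta>" "has_wirtinger f c d (g \<zeta>)"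
  shows "has_wirtinger (\<lambda>u. f (g u)) (c * a + d * cnj b) (c * b + d * cnj a) \<zeta>"
  using has_derivative_compose[OF assms[unfolded has_wirtinger_def]]
  by (simp add: has_wirtinger_def algebra_simps)

lemma has_wirtinger_cnj_power:
  "has_wirtinger (\<lambda>u. cnj u ^ n) 0 (of_nat n * cnj \<zeta> ^ (n - 1)) \<zeta>"
proof (induction n)
  case 0
  show ?case by (simp add: has_wirtinger_const)
next
  case (Suc n)
  show ?case
    using has_wirtinger_mult[OF has_wirtinger_cnj Suc] by (cases n) (simp_all add: algebra_simps)
qed

definition gauss :: "complex \<Rightarrow> complex" where
  "gauss u = of_real (exp (- (cmod u)\<^sup>2))"

lemma gauss_eq: "gauss u = exp (- (u * cnj u))"
  by (simp only: gauss_def exp_of_real[symmetric] of_real_minus complex_norm_square)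

lemma has_wirtinger_gauss: "has_wirtinger gauss (- cnj \<zeta> * gauss \<zeta>) (- \<zeta> * gauss \<zeta>) \<zeta>"
proof -
  have "((\<lambda>u. exp (- (u * cnj u))) has_derivative
      (\<lambda>h. exp (- (\<zeta> * cnj \<zeta>)) * - (\<zeta> * cnj h + h * cnj \<zeta>))) (at \<zeta>)"
    by (rule has_derivative_compose[where g = exp and f = "\<lambda>u. - (u * cnj u)"])
      (auto intro!: derivative_eq_intros DERIV_exp[THEN has_field_derivative_imp_has_derivative])
  then show ?thesis
    by (simp add: has_wirtinger_def gauss_eq[abs_def] algebra_simps)
qed

text \<open>Powers of \<open>cnj u\<close> are constants for \<open>wirtinger\<close>, so each
  application only brings down a factor \<open>- cnj u\<close> from \<open>gauss\<close>.\<close>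

lemma wirtinger_funpow_gauss:
  "(wirtinger ^^ n) gauss = (\<lambda>u. (-1) ^ n * (cnj u ^ n * gauss u))"
proof (induction n)
  case (Suc n)
  have "wirtinger (\<lambda>u. (-1) ^ n * (cnj u ^ n * gauss u)) \<zeta> = (-1) ^ Suc n * (cnj \<zeta> ^ Suc n * gauss \<zeta>)"
    for \<zeta>
    using has_wirtinger_imp_wirtinger(1)[OF has_wirtinger_cmult[OF
        has_wirtinger_mult[OF has_wirtinger_cnj_power has_wirtinger_gauss]]]
    by simp
  then show ?case by (simp add: Suc fun_eq_iff)
qed simp

text \<open>For \<open>n = 0\<close> the index \<open>n - 1\<close> is a junk value, multiplied by \<open>0\<close>.\<close>

primrec hpoly :: "nat \<Rightarrow> nat \<Rightarrow> complex \<Rightarrow> complex" where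
  "hpoly 0 n \<zeta> = cnj \<zeta> ^ n"
| "hpoly (Suc m) n \<zeta> = \<zeta> * hpoly m n \<zeta> - of_nat n * hpoly m (n - 1) \<zeta>"

text \<open>The induction varies \<open>n\<close> because the recursion also calls
  \<open>hpoly m (n - 1)\<close>.\<close>

lemma has_wirtinger_hpoly:
  "has_wirtinger (hpoly m n) (of_nat m * hpoly (m - 1) n \<zeta>) (of_nat n * hpoly m (n - 1) \<zeta>) \<zeta>"
proof (induction m arbitrary: n)
  case 0
  show ?case using has_wirtinger_cnj_power by (simp add: hpoly.simps(1)[abs_def])
next
  case (Suc m)
  have "hpoly (Suc m) n = (\<lambda>u. u * hpoly m n u - of_nat n * hpoly m (n - 1) u)"
    by (simp add: fun_eq_iff)
  with has_wirtinger_diff[OF has_wirtinger_mult[OF has_wirtinger_ident Suc]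
      has_wirtinger_cmult[OF Suc], of n "of_nat n" "n - 1"]
  show ?case by (cases m) (simp_all add: algebra_simps)
qed

text \<open>This is the recursion of \<open>hpoly\<close> one step below \<open>m\<close>,
  multiplied by \<open>m\<close>; for \<open>m = 0\<close> both sides vanish.\<close>

lemma hpoly_eigen:
  "\<zeta> * (of_nat m * hpoly (m - 1) n \<zeta>) - of_nat n * (of_nat m * hpoly (m - 1) (n - 1) \<zeta>) =
    of_nat m * hpoly m n \<zeta>"
  by (cases m) (simp_all add: algebra_simps)

lemma hpoly_Suc_right:
  "hpoly m (Suc n) \<zeta> = cnj \<zeta> * hpoly m n \<zeta> - of_nat m * hpoly (m - 1) n \<zeta>"
proof (induction m arbitrary: n)
  case (Suc m)
  \<comment> \<open>The induction hypothesis at \<open>n - 1\<close> speaks of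
    \<open>hpoly m n\<close> only for positive \<open>n\<close>; the factor \<open>of_nat n\<close>
    absorbs the case \<open>n = 0\<close>.\<close>
  have "of_nat n * hpoly m n \<zeta> =
      of_nat n * (cnj \<zeta> * hpoly m (n - 1) \<zeta> - of_nat m * hpoly (m - 1) (n - 1) \<zeta>)"
    by (cases n) (simp_all add: Suc)
  with hpoly_eigen[of \<zeta> m n] show ?case
    unfolding hpoly.simps Suc diff_Suc_1 of_nat_Suc by algebra
qed simp

text \<open>Differentiating \<open>hpoly m n u * gauss u\<close> gives
  \<open>(of_nat n * hpoly m (n - 1) u - u * hpoly m n u) * gauss u\<close>, and the bracket is
  \<open>- hpoly (Suc m) n u\<close> by the recursion.\<close>

lemma wirtinger_cnj_funpow_gauss:
  "(wirtinger_cnj ^^ m) (\<lambda>u. (-1) ^ n * (cnj u ^ n * gauss u)) =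
    (\<lambda>u. (-1) ^ (m + n) * (hpoly m n u * gauss u))"
proof (induction m)
  case (Suc m)
  have "wirtinger_cnj (\<lambda>u. (-1) ^ (m + n) * (hpoly m n u * gauss u)) \<zeta> =
      (-1) ^ (Suc m + n) * (hpoly (Suc m) n \<zeta> * gauss \<zeta>)" for \<zeta>
    by (subst has_wirtinger_imp_wirtinger(2)[OF has_wirtinger_cmult[OF
          has_wirtinger_mult[OF has_wirtinger_hpoly has_wirtinger_gauss]]])
      (simp add: algebra_simps)
  then show ?case by (simp add: Suc fun_eq_iff)
qed simp

lemma hermite_H_eq_hpoly: "hermite_H m n = hpoly m n"
proof
  fix \<zeta>
  have "hermite_H m n \<zeta> = (-1) ^ (m + n) * of_real (exp ((cmod \<zeta>)\<^sup>2)) *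
      ((-1) ^ (m + n) * (hpoly m n \<zeta> * gauss \<zeta>))"
    by (simp only: hermite_H_def gauss_def[abs_def, symmetric] wirtinger_funpow_gauss
        wirtinger_cnj_funpow_gauss)
  also have "\<dots> = ((-1) ^ (m + n) * (-1) ^ (m + n)) *
      (of_real (exp ((cmod \<zeta>)\<^sup>2)) * gauss \<zeta>) * hpoly m n \<zeta>"
    by (simp only: mult_ac)
  also have "of_real (exp ((cmod \<zeta>)\<^sup>2)) * gauss \<zeta> = 1"
    unfolding gauss_def of_real_mult[symmetric] exp_add[symmetric] by simp
  finally show "hermite_H m n \<zeta> = hpoly m n \<zeta>"
    by (simp flip: power_mult_distrib)
qed

text \<open>If \<open>hpoly (Suc m) n\<close> vanished identically, so would its derivative, a
  nonzero multiple of \<open>hpoly m n\<close>.\<close>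

lemma hpoly_not_zero: "\<exists>\<zeta>. hpoly m n \<zeta> \<noteq> 0"
proof (induction m)
  case 0
  show ?case by (intro exI[of _ 1]) simp
next
  case (Suc m)
  show ?case
  proof (rule ccontr)
    assume "\<not> ?case"
    then have "hpoly (Suc m) n = (\<lambda>_. 0)" by auto
    then have "of_nat (Suc m) * hpoly m n \<zeta> = 0" for \<zeta>
      using has_wirtinger_imp_wirtinger(1)[OF has_wirtinger_hpoly[of "Suc m" n \<zeta>]]
        has_wirtinger_imp_wirtinger(1)[OF has_wirtinger_const[of 0 \<zeta>]]
      by simp
    with Suc show False by (auto simp del: of_nat_Suc)
  qed
qed

text \<open>\<open>xi\<close> is holomorphic and \<open>xi_star\<close> antiholomorphic in
  \<open>z\<close> and \<open>w\<close>. In each operator the contributions of one factor add up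
  while those of the other cancel, by the sign of \<i>.\<close>

lemma A_product:
  fixes F G :: "complex \<Rightarrow> complex"
  assumes F: "\<And>\<zeta>. has_wirtinger F (a \<zeta>) (b \<zeta>) \<zeta>"
    and G: "\<And>\<zeta>. has_wirtinger G (c \<zeta>) (d \<zeta>) \<zeta>"
  defines "f \<equiv> \<lambda>p. F (xi p) * G (xi_star p)"
  shows "A_xi f = (\<lambda>p. a (xi p) * G (xi_star p))"
    and "A_xi_bar f = (\<lambda>p. b (xi p) * G (xi_star p))"
    and "A_xi_star f = (\<lambda>p. F (xi p) * c (xi_star p))"
    and "A_xi_tilde f = (\<lambda>p. F (xi p) * d (xi_star p))"
proof -
  have xi_z: "has_wirtinger (\<lambda>u. xi (u, w)) 1 0 z" for z w
    using has_wirtinger_add[OF has_wirtinger_ident has_wirtinger_const] by (simp add: xi_def)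
  have xi_w: "has_wirtinger (\<lambda>u. xi (z, u)) \<i> 0 w" for z w
    using has_wirtinger_add[OF has_wirtinger_const has_wirtinger_cmult[OF has_wirtinger_ident]]
    by (simp add: xi_def)
  have xs_z: "has_wirtinger (\<lambda>u. xi_star (u, w)) 0 1 z" for z w
    using has_wirtinger_add[OF has_wirtinger_cnj has_wirtinger_const] by (simp add: xi_star_def)
  have xs_w: "has_wirtinger (\<lambda>u. xi_star (z, u)) 0 \<i> w" for z w
    using has_wirtinger_add[OF has_wirtinger_const has_wirtinger_cmult[OF has_wirtinger_cnj]]
    by (simp add: xi_star_def)
  note dz = has_wirtinger_imp_wirtinger[OF has_wirtinger_mult[OF
        has_wirtinger_compose[OF xi_z F] has_wirtinger_compose[OF xs_z G]]]
  note dw = has_wirtinger_imp_wirtinger[OF has_wirtinger_mult[OF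
        has_wirtinger_compose[OF xi_w F] has_wirtinger_compose[OF xs_w G]]]
  note D = D_z_def D_zbar_def D_w_def D_wbar_def f_def
  show "A_xi f = (\<lambda>p. a (xi p) * G (xi_star p))"
    by (auto simp: fun_eq_iff A_xi_def D dz dw field_simps)
  show "A_xi_bar f = (\<lambda>p. b (xi p) * G (xi_star p))"
    by (auto simp: fun_eq_iff A_xi_bar_def D dz dw field_simps)
  show "A_xi_star f = (\<lambda>p. F (xi p) * c (xi_star p))"
    by (auto simp: fun_eq_iff A_xi_star_def D dz dw field_simps)
  show "A_xi_tilde f = (\<lambda>p. F (xi p) * d (xi_star p))"
    by (auto simp: fun_eq_iff A_xi_tilde_def D dz dw field_simps)
qed

text \<open>The counterpart of \<open>hpoly_eigen\<close> for the second index, from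
  \<open>hpoly_Suc_right\<close> at \<open>n - 1\<close> multiplied by \<open>n\<close>.\<close>

lemma hpoly_eigen_cnj:
  "cnj \<zeta> * (of_nat n * hpoly m (n - 1) \<zeta>) - of_nat n * (of_nat m * hpoly (m - 1) (n - 1) \<zeta>) =
    of_nat n * hpoly m n \<zeta>"
  by (cases n) (simp_all add: hpoly_Suc_right algebra_simps)

lemma hermite_H4_not_zero: "hermite_H4 m n m' n' \<noteq> (\<lambda>_. 0)"
proof -
  obtain a b where ab: "hpoly m n a \<noteq> 0" "hpoly m' n' b \<noteq> 0"
    using hpoly_not_zero by blast
  \<comment> \<open>The solution of \<open>z + \<i> * w = a\<close> and
    \<open>z - \<i> * w = cnj b\<close>; the latter is the conjugate of
    \<open>xi_star p = b\<close>.\<close>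
  define p where "p = ((a + cnj b) / 2, (a - cnj b) / (2 * \<i>))"
  have "xi p = a" "xi_star p = b"
    by (simp_all add: p_def xi_def xi_star_def field_simps)
  with ab have "hermite_H4 m n m' n' p \<noteq> 0"
    by (simp add: hermite_H4_def hermite_H_eq_hpoly)
  then show ?thesis by auto
qed

theorem lemma3p11:
  fixes m n m' n' :: nat
  shows "eigenfunction L_xi (of_nat m) (hermite_H4 m n m' n') \<and>
         eigenfunction L_xi_bar (of_nat n) (hermite_H4 m n m' n') \<and>
         eigenfunction L_xi_star (of_nat m') (hermite_H4 m n m' n') \<and>
         eigenfunction L_xi_tilde (of_nat n') (hermite_H4 m n m' n')"
proof -
  \<comment> \<open>After \<open>A_xi_bar\<close> or \<open>A_xi_tilde\<close> the function is again
    a product, with one factor scaled by an index. The two extra instances let the outer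
    \<open>A_xi\<close> and \<open>A_xi_star\<close> act on it.\<close>
  note A = A_product[OF has_wirtinger_hpoly has_wirtinger_hpoly]
    A_product(1)[OF has_wirtinger_cmult[OF has_wirtinger_hpoly] has_wirtinger_hpoly]
    A_product(3)[OF has_wirtinger_hpoly has_wirtinger_cmult[OF has_wirtinger_hpoly]]
  note L = L_xi_def L_xi_bar_def L_xi_star_def L_xi_tilde_def
  have H: "hermite_H4 m n m' n' = (\<lambda>p. hpoly m n (xi p) * hpoly m' n' (xi_star p))"
    by (simp add: hermite_H4_def hermite_H_eq_hpoly)
  have "L_xi (hermite_H4 m n m' n') = (\<lambda>p. of_nat m * hermite_H4 m n m' n' p)"
    unfolding L H A hpoly_eigen[symmetric] mult.assoc[symmetric]
    by (simp add: fun_eq_iff algebra_simps)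
  moreover have "L_xi_bar (hermite_H4 m n m' n') = (\<lambda>p. of_nat n * hermite_H4 m n m' n' p)"
    unfolding L H A mult.assoc[symmetric] hpoly_eigen_cnj[symmetric]
    by (simp add: fun_eq_iff xi_bar_eq_cnj_xi algebra_simps)
  moreover have "L_xi_star (hermite_H4 m n m' n') = (\<lambda>p. of_nat m' * hermite_H4 m n m' n' p)"
    unfolding L H A mult.left_commute[of "of_nat m'"] hpoly_eigen[symmetric]
    by (simp add: fun_eq_iff algebra_simps)
  moreover have "L_xi_tilde (hermite_H4 m n m' n') = (\<lambda>p. of_nat n' * hermite_H4 m n m' n' p)"
    unfolding L H A mult.left_commute[of "of_nat n'"] hpoly_eigen_cnj[symmetric]
    by (simp add: fun_eq_iff xi_tilde_eq_cnj_xi_star algebra_simps)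
  ultimately show ?thesis
    by (simp add: eigenfunction_def hermite_H4_not_zero)
qed

end
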